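(* Let $d=1$ and suppose that the family $(A_g)_{g\in E}$ satisfies Assumptions 1)–6) and 7a) listed in the context. For $r>0$ let $\beta(r)=\beta(T_1,T_2)$ be the absolute regularity coefficient of $\xi$ for $T_1=(-\infty,0]$ and $T_2=[r,+\infty)$. Then $\xi$ is absolutely regular, i.e. $\beta(r)\to0$ as $r\to\infty$, and for all $r>0$, $$\beta(r)\le C_1 e^{-F(C_2 r)},$$ where one can choose $C_1=16$ and $C_2=\frac1{2M}$, with $M$ the constant of Assumption 5).
   Context: Notation. $\mathbb{R}^+=[0,\infty)$, $E=\mathbb{R}\times\mathbb{R}^+$ (so $d=1$). A germ is a point $g=(x_g,t_g)\in E$ ($x_g$ = location, $t_g$ = birth time). $\mathcal N$ is a Poisson point process on $E$ (viewed as a random locally finite set of germs) with intensity measure $\Lambda=\lambda\times m$, where $\lambda$ is Lebesgue measure on $\mathbb{R}$ and $m$ is a nonzero measure on $\mathbb{R}^+$ with $m([0,a])<\infty$ for all $a>0$. To each $g\in E$ is associated a (deterministic) function $A_g:\mathbb{R}\to\mathbb{R}^+$; the free crystal of $g$ at time $t\ge 0$ is $C_g(t)=\{x: A_g(x)\le t\}$. The random field is $\xi(x)=\inf_{g\in\mathcal N}A_g(x)$. The causal cone is $K_t=\{g\in E: A_g(0)\le t\}$ and $F(t)=\Lambda(K_t)$. Assumptions. 1) For all $g=(x_g,t_g)\in E$ and $x\in\mathbb{R}$: $A_g(x)=A_{(0,t_g)}(x-x_g)$. 2) For all $g\in E$: $A_g(x_g)=t_g$ and $A_g(x)\ge t_g$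 for all $x\in\mathbb{R}$. 3) The free crystals $C_g(t)$ are bounded convex sets, and $C_g(s)\subset C_g(t)$ for $0\le s<t$. 4) The functions $x\mapsto A_g(x)$ are continuous and $\partial C_g(t)=\{x: A_g(x)=t\}$. 5) There exists $M>0$ such that for all $t_g\in\mathbb{R}^+$ and $x\in\mathbb{R}$: $A_{(0,t_g)}(x)\ge t_g+\frac1M|x|$. 6) For all $g=(0,t_g)$ and all $r>0$ there exists $t>0$ with $C_g(t)\supset [-r,r]$. 7a) For all $g_1,g_2\in E$: if $A_{g_1}(x_0)\ge A_{g_2}(x_0)$ for some $x_0\ge x_{g_1}$, then $A_{g_1}(x)\ge A_{g_2}(x)$ for all $x\ge x_0$; and if $A_{g_1}(x_1)\ge A_{g_2}(x_1)$ for some $x_1\le x_{g_1}$, then $A_{g_1}(x)\ge A_{g_2}(x)$ for all $x\le x_1$. Absolute regularity coefficient. For disjoint $T_1,T_2\subset\mathbb{R}$, $\beta(T_1,T_2)=\|\mathcal P_{T_1\cup T_2}-\mathcal P_{T_1}\times\mathcal P_{T_2}\|_{var}$, where $\mathcal P_T$ is the distribution of the restriction $\xi_{|T}$ in the space $\mathcal C(T)$ of continuous real functions on $T$, $\mathcal C(T_1\cup T_2)$ is identified with $\mathcal C(T_1)\times\mathcal C(T_2)$, and $\|\cdot\|_{var}$ is the total variation norm (so $\|P-Q\|_{var}=2\sup_A|P(A)-Q(A)|$ for probability measures). *)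

theory Defs
  imports "HOL-Probability.Probability"
begin

text \<open>A germ is a pair (location, birth time).\<close>

definition germs :: "(real \<times> real) set" where
  "germs = UNIV \<times> {0..}"

text \<open>A Poisson process as a random locally finite subset of the space of \<open>\<Lambda>\<close>.  The
  intensity \<open>\<Lambda>\<close> is meant to be diffuse and finite on bounded sets, so that the process is simple
  and the counts below determine its law.  The Poisson weights are written out because
  \<^const>\<open>poisson_pmf\<close> excludes the rate 0.\<close>

definition poisson_process ::
    "'w measure \<Rightarrow> 'g::metric_space measure \<Rightarrow> ('w \<Rightarrow> 'g set) \<Rightarrow> bool" where
  "poisson_process P \<Lambda> N \<longleftrightarrow>
     (\<forall>\<omega>\<in>space P. N \<omega> \<subseteq> space \<Lambda> \<and> (\<forall>B. bounded B \<longrightarrow> finite (N \<omega> \<inter> B))) \<and>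
     (\<forall>B\<in>sets \<Lambda>. bounded B \<longrightarrow>
        (\<lambda>\<omega>. card (N \<omega> \<inter> B)) \<in> measurable P (count_space UNIV) \<and>
        (\<forall>k. measure P {\<omega> \<in> space P. card (N \<omega> \<inter> B) = k}
               = measure \<Lambda> B ^ k / fact k * exp (- measure \<Lambda> B))) \<and>
     (\<forall>\<B>. finite \<B> \<and> disjoint \<B> \<and> (\<forall>B\<in>\<B>. B \<in> sets \<Lambda> \<and> bounded B) \<longrightarrow>
        prob_space.indep_vars P (\<lambda>_. count_space UNIV) (\<lambda>B \<omega>. card (N \<omega> \<inter> B)) \<B>)"

definition free_crystal :: "(real \<times> real \<Rightarrow> real \<Rightarrow> real) \<Rightarrow> real \<times> real \<Rightarrow> real \<Rightarrow> real set" where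
  "free_crystal A g t = {x. A g x \<le> t}"

text \<open>If \<open>N \<omega>\<close> is empty, the field is an unspecified constant.  This is a null event for a
  Poisson process with infinite total intensity.\<close>

definition crystal_field ::
    "(real \<times> real \<Rightarrow> real \<Rightarrow> real) \<Rightarrow> ('w \<Rightarrow> (real \<times> real) set) \<Rightarrow> 'w \<Rightarrow> real \<Rightarrow> real" where
  "crystal_field A N \<omega> x = (INF g\<in>N \<omega>. A g x)"

definition causal_cone :: "(real \<times> real \<Rightarrow> real \<Rightarrow> real) \<Rightarrow> real \<Rightarrow> (real \<times> real) set" where
  "causal_cone A t = {g \<in> germs. A g 0 \<le> t}"

text \<open>The space of continuous real functions on \<open>T\<close>, represented by functions that are
  \<^const>\<open>undefined\<close> outside \<open>T\<close>, with the \<open>\<sigma>\<close>-algebra generated by the evaluations at the points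
  of \<open>T\<close>.  For closed \<open>T\<close> this is the Borel \<open>\<sigma>\<close>-algebra of locally uniform convergence.\<close>

definition cont_space :: "real set \<Rightarrow> (real \<Rightarrow> real) measure" where
  "cont_space T = restrict_space (Pi\<^sub>M T (\<lambda>_. borel)) {f. continuous_on T f}"

definition field_law :: "'w measure \<Rightarrow> ('w \<Rightarrow> real \<Rightarrow> real) \<Rightarrow> real set \<Rightarrow> (real \<Rightarrow> real) measure" where
  "field_law P \<xi> T = distr P (cont_space T) (\<lambda>\<omega>. restrict (\<xi> \<omega>) T)"

text \<open>Total variation of the signed measure \<open>P - Q\<close>, for finite measures \<open>P\<close> and \<open>Q\<close> on the
  same \<open>\<sigma>\<close>-algebra.\<close>

definition variation_norm_diff :: "'a measure \<Rightarrow> 'a measure \<Rightarrow> real" where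
  "variation_norm_diff P Q =
     (SUP \<A> \<in> {\<A>. finite \<A> \<and> \<A> \<subseteq> sets P \<and> partition_on (space P) \<A>}.
        \<Sum>A\<in>\<A>. \<bar>measure P A - measure Q A\<bar>)"

lemma variation_norm_diff_eq:
  fixes P Q :: "'a measure"
  assumes P: "prob_space P" and Q: "prob_space Q" and sets_eq: "sets Q = sets P"
  shows "variation_norm_diff P Q = 2 * (SUP A \<in> sets P. \<bar>measure P A - measure Q A\<bar>)"
proof -
  interpret P: prob_space P by fact
  interpret Q: prob_space Q by fact
  have space_eq: "space Q = space P" using sets_eq by (rule sets_eq_imp_space_eq)
  define d where "d A = measure P A - measure Q A" for A
  define S where "S = (SUP A \<in> sets P. \<bar>d A\<bar>)"
  define Parts where "Parts = {\<A>. finite \<A> \<and> \<A> \<subseteq> sets P \<and> partition_on (space P) \<A>}"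
  have d_le1: "\<bar>d A\<bar> \<le> 1" for A
    unfolding d_def using P.prob_le_1[of A] Q.prob_le_1[of A]
      measure_nonneg[of P A] measure_nonneg[of Q A] by linarith
  have bdd: "bdd_above ((\<lambda>A. \<bar>d A\<bar>) ` sets P)"
    using d_le1 by (intro bdd_aboveI2[of _ _ 1])
  have d_Union: "(\<Sum>A\<in>\<A>. d A) = d (\<Union>\<A>)"
    if "finite \<A>" "\<A> \<subseteq> sets P" "disjoint \<A>" for \<A>
  proof -
    have "measure P (\<Union>\<A>) = (\<Sum>A\<in>\<A>. measure P A)"
      using P.finite_measure_finite_Union[of \<A> "\<lambda>A. A"] that
      by (auto simp: disjoint_family_on_def disjoint_def)
    moreover have "measure Q (\<Union>\<A>) = (\<Sum>A\<in>\<A>. measure Q A)"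
      using Q.finite_measure_finite_Union[of \<A> "\<lambda>A. A"] that sets_eq
      by (auto simp: disjoint_family_on_def disjoint_def)
    ultimately show ?thesis by (simp add: d_def sum_subtractf)
  qed
  have d_space: "d (space P) = 0"
    using P.prob_space Q.prob_space by (simp add: d_def space_eq)
  have upper: "(\<Sum>A\<in>\<A>. \<bar>d A\<bar>) \<le> 2 * S" if "\<A> \<in> Parts" for \<A>
  proof -
    have \<A>: "finite \<A>" "\<A> \<subseteq> sets P" "\<Union>\<A> = space P" "disjoint \<A>"
      using that by (auto simp: Parts_def partition_on_def)
    let ?\<P> = "{A\<in>\<A>. d A \<ge> 0}"
    have "(\<Sum>A\<in>\<A>. \<bar>d A\<bar>) + (\<Sum>A\<in>\<A>. d A) = (\<Sum>A\<in>\<A>. if d A \<ge> 0 then 2 * d A else 0)"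
      unfolding sum.distrib[symmetric] by (intro sum.cong) auto
    also have "\<dots> = 2 * (\<Sum>A\<in>?\<P>. d A)"
      using \<A>(1) by (auto simp: sum.inter_filter sum_distrib_left intro!: sum.cong)
    also have "(\<Sum>A\<in>?\<P>. d A) = d (\<Union>?\<P>)"
      using \<A> by (intro d_Union) (auto simp: disjoint_def)
    finally have "(\<Sum>A\<in>\<A>. \<bar>d A\<bar>) = 2 * d (\<Union>?\<P>)"
      using d_Union[OF \<A>(1,2,4)] \<A>(3) d_space by simp
    moreover have "\<Union>?\<P> \<in> sets P"
      using \<A> by (intro sets.finite_Union) auto
    then have "\<bar>d (\<Union>?\<P>)\<bar> \<le> S" unfolding S_def by (intro cSUP_upper bdd)
    ultimately show ?thesis by linarith
  qed
  have Parts_ne: "Parts \<noteq> {}"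
  proof -
    have "{space P} \<in> Parts"
      using P.not_empty by (auto simp: Parts_def partition_on_def)
    then show ?thesis by blast
  qed
  define V where "V = (SUP \<A>\<in>Parts. \<Sum>A\<in>\<A>. \<bar>d A\<bar>)"
  have bddV: "bdd_above ((\<lambda>\<A>. \<Sum>A\<in>\<A>. \<bar>d A\<bar>) ` Parts)"
    using upper by (intro bdd_aboveI2)
  have "V \<le> 2 * S"
    unfolding V_def using upper Parts_ne by (intro cSUP_least)
  moreover have "S \<le> V / 2"
    unfolding S_def
  proof (rule cSUP_least)
    show "sets P \<noteq> {}" using sets.top by blast
  next
    fix A assume A: "A \<in> sets P"
    let ?\<A> = "{A, space P - A} - {{}}"
    have sub: "A \<subseteq> space P" using A by (rule sets.sets_into_space)
    have in_Parts: "?\<A> \<in> Parts"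
      using A sub by (auto simp: Parts_def partition_on_def disjoint_def)
    have compl: "d (space P - A) = - d A"
      using A sets_eq P.prob_compl[of A] Q.prob_compl[of A] by (simp add: d_def space_eq)
    have "A \<noteq> space P - A" using sub P.not_empty by blast
    then have "2 * \<bar>d A\<bar> = (\<Sum>B\<in>{A, space P - A}. \<bar>d B\<bar>)"
      by (simp add: compl)
    also have "\<dots> = (\<Sum>B\<in>?\<A>. \<bar>d B\<bar>)"
      by (intro sum.mono_neutral_right) (auto simp: d_def)
    also have "\<dots> \<le> V" unfolding V_def by (intro cSUP_upper bddV in_Parts)
    finally show "\<bar>d A\<bar> \<le> V / 2" by simp
  qed
  ultimately have "V = 2 * S" by linarith
  then show ?thesis
    by (simp add: variation_norm_diff_def V_def S_def d_def Parts_def)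
qed

text \<open>The outer \<^const>\<open>distr\<close> is the identification of \<open>C(T1 \<union> T2)\<close> with \<open>C(T1) \<times> C(T2)\<close>, which is
  legitimate for disjoint closed \<open>T1\<close> and \<open>T2\<close>.\<close>

definition abs_reg_coeff ::
    "'w measure \<Rightarrow> ('w \<Rightarrow> real \<Rightarrow> real) \<Rightarrow> real set \<Rightarrow> real set \<Rightarrow> real" where
  "abs_reg_coeff P \<xi> T1 T2 =
     variation_norm_diff
       (distr (field_law P \<xi> (T1 \<union> T2)) (cont_space T1 \<Otimes>\<^sub>M cont_space T2)
          (\<lambda>f. (restrict f T1, restrict f T2)))
       (field_law P \<xi> T1 \<Otimes>\<^sub>M field_law P \<xi> T2)"

end

theory Submission
  imports Defs
begin

text \<open>Let \<open>t = r / (2 M)\<close>.  By 5), every germ reaching \<open>0\<close> by time \<open>t\<close> lies in the slab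
  \<open>\<bar>x\<bar> \<le> r / 2\<close>, and every germ reaching \<open>r\<close> by time \<open>t\<close> lies to the right of \<open>r / 2\<close>.  If
  some germ of the process reaches \<open>0\<close> by time \<open>t\<close>, it beats at \<open>0\<close> every germ located beyond
  \<open>r / 2\<close>, and by 7a) it beats them on all of \<open>(-\<infinity>, 0]\<close>; so there the field coincides with the
  field built from the germs located left of \<open>r / 2\<close>.  Symmetrically on \<open>[r, \<infinity>)\<close>.  The two
  one-sided fields are independent, and each coupling fails with probability \<open>exp (- F t)\<close>, the
  void probability of the causal cone.  Comparing both the joint law and the product of the
  marginals with the law of the independent pair gives \<open>\<beta> r \<le> 8 exp (- F t)\<close>.

  The one-sided fields are functions of the void events \<open>N \<inter> B = {}\<close> only.  These form a
  \<open>\<pi>\<close>-system, so independence over disjoint regions is just additivity of the intensity in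
  the exponent of the void probabilities.\<close>

section \<open>Void probabilities and independence over disjoint regions\<close>

text \<open>Void means count 0, because the trace of the process on a bounded set is finite; on an
  infinite set \<open>card\<close> would also return 0.\<close>

lemma poisson_process_void_prob:
  assumes "poisson_process P \<Lambda> N" "B \<in> sets \<Lambda>" "bounded B"
  shows "{\<omega> \<in> space P. N \<omega> \<inter> B = {}} \<in> sets P"
    and "measure P {\<omega> \<in> space P. N \<omega> \<inter> B = {}} = exp (- measure \<Lambda> B)"
proof -
  have fin: "finite (N \<omega> \<inter> B)" if "\<omega> \<in> space P" for \<omega>
    using assms that by (auto simp: poisson_process_def)
  have eq: "{\<omega> \<in> space P. N \<omega> \<inter> B = {}} = {\<omega> \<in> space P. card (N \<omega> \<inter> B) = 0}"
    using fin by auto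
  have meas: "(\<lambda>\<omega>. card (N \<omega> \<inter> B)) \<in> measurable P (count_space UNIV)"
    using assms by (auto simp: poisson_process_def)
  have "(\<lambda>\<omega>. card (N \<omega> \<inter> B)) -` {0} \<inter> space P \<in> sets P"
    by (rule measurable_sets[OF meas]) simp
  also have "(\<lambda>\<omega>. card (N \<omega> \<inter> B)) -` {0} \<inter> space P = {\<omega> \<in> space P. card (N \<omega> \<inter> B) = 0}"
    by auto
  finally show "{\<omega> \<in> space P. N \<omega> \<inter> B = {}} \<in> sets P"
    unfolding eq .
  have "\<forall>k. measure P {\<omega> \<in> space P. card (N \<omega> \<inter> B) = k}
               = measure \<Lambda> B ^ k / fact k * exp (- measure \<Lambda> B)"
    using assms unfolding poisson_process_def by blast
  from spec[OF this, of 0] show "measure P {\<omega> \<in> space P. N \<omega> \<inter> B = {}} = exp (- measure \<Lambda> B)"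
    unfolding eq by simp
qed

text \<open>The test sets \<open>B\<close> are bounded because counts are prescribed only on bounded
  sets. The region \<open>H\<close> is arbitrary, which allows half-planes.\<close>

definition void_events ::
    "'w measure \<Rightarrow> 'g::metric_space measure \<Rightarrow> ('w \<Rightarrow> 'g set) \<Rightarrow> 'g set \<Rightarrow> 'w set set" where
  "void_events P \<Lambda> N H =
     {{\<omega> \<in> space P. N \<omega> \<inter> B = {}} | B. B \<in> sets \<Lambda> \<and> bounded B \<and> B \<subseteq> H}"

lemma void_events_sets:
  "poisson_process P \<Lambda> N \<Longrightarrow> void_events P \<Lambda> N H \<subseteq> sets P"
  by (auto simp: void_events_def intro: poisson_process_void_prob(1))

text \<open>Missing both \<open>B\<close> and \<open>C\<close> is the same as missing
  \<open>B \<union> C\<close>, which is again bounded and inside \<open>H\<close>.\<close>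

lemma Int_stable_void_events: "Int_stable (void_events P \<Lambda> N H)"
proof (rule Int_stableI)
  fix a b assume "a \<in> void_events P \<Lambda> N H" "b \<in> void_events P \<Lambda> N H"
  then obtain B C where "B \<in> sets \<Lambda>" "bounded B" "B \<subseteq> H" "a = {\<omega> \<in> space P. N \<omega> \<inter> B = {}}"
    and "C \<in> sets \<Lambda>" "bounded C" "C \<subseteq> H" "b = {\<omega> \<in> space P. N \<omega> \<inter> C = {}}"
    by (auto simp: void_events_def)
  then show "a \<inter> b \<in> void_events P \<Lambda> N H"
    unfolding void_events_def by (intro CollectI exI[of _ "B \<union> C"]) auto
qed

text \<open>For \<open>B\<close> and \<open>C\<close> in disjoint regions, the exponent of the void
  probability of \<open>B \<union> C\<close> splits into a sum, so the probabilities multiply.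
  Finite intensity makes the real-valued \<open>measure\<close> additive here. Intersection
  stability then carries independence to the generated \<open>\<sigma>\<close>-algebras.\<close>

lemma indep_void_events:
  assumes "prob_space P" and pp: "poisson_process P \<Lambda> N"
    and finite: "\<And>B. B \<in> sets \<Lambda> \<Longrightarrow> bounded B \<Longrightarrow> emeasure \<Lambda> B \<noteq> \<infinity>"
    and disj: "H \<inter> H' = {}"
  shows "prob_space.indep_set P (sigma_sets (space P) (void_events P \<Lambda> N H))
           (sigma_sets (space P) (void_events P \<Lambda> N H'))"
proof -
  interpret prob_space P by fact
  show ?thesis
  proof (rule indep_set_sigma_sets[OF _ Int_stable_void_events Int_stable_void_events],
      rule indep_setI[OF void_events_sets[OF pp] void_events_sets[OF pp]])
    fix a b assume "a \<in> void_events P \<Lambda> N H" "b \<in> void_events P \<Lambda> N H'"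
    then obtain B C where B: "B \<in> sets \<Lambda>" "bounded B" "B \<subseteq> H" "a = {\<omega> \<in> space P. N \<omega> \<inter> B = {}}"
      and C: "C \<in> sets \<Lambda>" "bounded C" "C \<subseteq> H'" "b = {\<omega> \<in> space P. N \<omega> \<inter> C = {}}"
      by (auto simp: void_events_def)
    have "a \<inter> b = {\<omega> \<in> space P. N \<omega> \<inter> (B \<union> C) = {}}"
      using B C by auto
    moreover have "measure \<Lambda> (B \<union> C) = measure \<Lambda> B + measure \<Lambda> C"
      using B C disj finite by (intro measure_Union) auto
    ultimately show "prob (a \<inter> b) = prob a * prob b"
      using B C by (simp add: poisson_process_void_prob[OF pp] exp_add[symmetric])
  qed
qed

text \<open>Passage from bounded to unbounded test sets: missing a countable union means missing
  every member.\<close>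

lemma void_UN_in_sigma:
  assumes "\<And>n::nat. B n \<in> sets \<Lambda>" "\<And>n. bounded (B n)" "\<And>n. B n \<subseteq> H"
  shows "{\<omega> \<in> space P. N \<omega> \<inter> (\<Union>n. B n) = {}} \<in> sets (sigma (space P) (void_events P \<Lambda> N H))"
proof -
  have "void_events P \<Lambda> N H \<subseteq> Pow (space P)"
    by (auto simp: void_events_def)
  moreover have "{\<omega> \<in> space P. N \<omega> \<inter> B n = {}} \<in> void_events P \<Lambda> N H" for n
    unfolding void_events_def using assms by (intro CollectI exI[of _ "B n"]) auto
  ultimately have "{\<omega> \<in> space P. N \<omega> \<inter> B n = {}} \<in> sets (sigma (space P) (void_events P \<Lambda> N H))" for n
    by auto
  then have "(\<Inter>n. {\<omega> \<in> space P. N \<omega> \<inter> B n = {}}) \<in> sets (sigma (space P) (void_events P \<Lambda> N H))"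
    by (intro sets.countable_INT) auto
  also have "(\<Inter>n. {\<omega> \<in> space P. N \<omega> \<inter> B n = {}}) = {\<omega> \<in> space P. N \<omega> \<inter> (\<Union>n. B n) = {}}"
    by auto
  finally show ?thesis .
qed

section \<open>Coupling estimates for the variation norm\<close>

text \<open>Outside \<open>D\<close> the variables agree, so the preimages of \<open>A\<close> under
  them can differ only inside \<open>D\<close>.\<close>

lemma coupling_inequality:
  assumes "prob_space Q" and Z: "Z \<in> measurable Q S" and Z': "Z' \<in> measurable Q S"
    and D: "D \<in> sets Q" and eq: "\<And>\<omega>. \<omega> \<in> space Q - D \<Longrightarrow> Z \<omega> = Z' \<omega>"
    and A: "A \<in> sets S"
  shows "\<bar>measure (distr Q S Z) A - measure (distr Q S Z') A\<bar> \<le> measure Q D"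
proof -
  interpret prob_space Q by fact
  have le: "prob (U -` A \<inter> space Q) \<le> prob (V -` A \<inter> space Q) + prob D"
    if "U \<in> measurable Q S" "V \<in> measurable Q S" "\<And>\<omega>. \<omega> \<in> space Q - D \<Longrightarrow> U \<omega> = V \<omega>" for U V
  proof -
    have meas: "V -` A \<inter> space Q \<in> sets Q"
      using that A by auto
    have "prob (U -` A \<inter> space Q) \<le> prob ((V -` A \<inter> space Q) \<union> D)"
      using that(3) meas D by (intro finite_measure_mono) auto
    also have "\<dots> \<le> prob (V -` A \<inter> space Q) + prob D"
      using meas D by (rule measure_Un_le)
    finally show ?thesis .
  qed
  from le[OF Z Z' eq] le[OF Z' Z eq[symmetric]] show ?thesis
    using Z Z' A by (simp add: measure_distr)
qed

text \<open>The law of \<open>(X, Y)\<close> and the product of its marginals are both compared with the law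
  of \<open>(X', Y')\<close>; for the second comparison the product of marginals is realised on
  \<open>P \<Otimes>\<^sub>M P\<close>.\<close>

lemma variation_norm_diff_coupling:
  assumes "prob_space P"
    and X: "X \<in> measurable P S" and Y: "Y \<in> measurable P T"
    and indep: "prob_space.indep_var P S X' T Y'"
    and D: "D1 \<in> sets P" "D2 \<in> sets P"
    and eqX: "\<And>\<omega>. \<omega> \<in> space P - D1 \<Longrightarrow> X \<omega> = X' \<omega>"
    and eqY: "\<And>\<omega>. \<omega> \<in> space P - D2 \<Longrightarrow> Y \<omega> = Y' \<omega>"
  shows "variation_norm_diff (distr P (S \<Otimes>\<^sub>M T) (\<lambda>\<omega>. (X \<omega>, Y \<omega>))) (distr P S X \<Otimes>\<^sub>M distr P T Y)
           \<le> 4 * (measure P D1 + measure P D2)"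
proof -
  interpret prob_space P by fact
  interpret PP: pair_prob_space P P ..
  have X': "X' \<in> measurable P S" and Y': "Y' \<in> measurable P T"
    using indep by (auto dest: indep_var_rv1 indep_var_rv2)
  have prod_law: "distr P S U \<Otimes>\<^sub>M distr P T V = distr (P \<Otimes>\<^sub>M P) (S \<Otimes>\<^sub>M T) (\<lambda>(a, b). (U a, V b))"
    if "U \<in> measurable P S" "V \<in> measurable P T" for U V
    using that by (intro pair_measure_distr)
      (auto intro: prob_space_imp_sigma_finite prob_space_distr)
  \<comment> \<open>Independence lets the law of \<open>(X', Y')\<close> be realised on the product
    space too, where it can be compared with the product of the marginals of \<open>X\<close> and
    \<open>Y\<close>.\<close>
  have joint: "distr P (S \<Otimes>\<^sub>M T) (\<lambda>\<omega>. (X' \<omega>, Y' \<omega>))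
      = distr (P \<Otimes>\<^sub>M P) (S \<Otimes>\<^sub>M T) (\<lambda>(a, b). (X' a, Y' b))"
    using indep unfolding indep_var_distribution_eq by (simp add: prod_law[OF X' Y'])
  \<comment> \<open>On the product space, \<open>E\<close> is the event that one of the two
    couplings fails; the coordinates are separate copies of the sample.\<close>
  define E where "E = (D1 \<times> space P) \<union> (space P \<times> D2)"
  have E: "E \<in> sets (P \<Otimes>\<^sub>M P)"
    using D by (auto simp: E_def)
  have "measure (P \<Otimes>\<^sub>M P) E \<le> measure (P \<Otimes>\<^sub>M P) (D1 \<times> space P) + measure (P \<Otimes>\<^sub>M P) (space P \<times> D2)"
    using D unfolding E_def by (intro measure_Un_le) auto
  also have "\<dots> = prob D1 + prob D2"
    using D by (simp add: measure_def emeasure_pair_measure_Times enn2real_mult emeasure_space_1)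
  finally have E_le: "measure (P \<Otimes>\<^sub>M P) E \<le> prob D1 + prob D2" .
  have D_le: "prob (D1 \<union> D2) \<le> prob D1 + prob D2"
    using D by (rule measure_Un_le)
  let ?L = "distr P (S \<Otimes>\<^sub>M T) (\<lambda>\<omega>. (X \<omega>, Y \<omega>))"
  let ?R = "distr P S X \<Otimes>\<^sub>M distr P T Y"
  have R: "?R = distr (P \<Otimes>\<^sub>M P) (S \<Otimes>\<^sub>M T) (\<lambda>(a, b). (X a, Y b))"
    by (rule prod_law[OF X Y])
  have "\<bar>measure ?L A - measure ?R A\<bar> \<le> 2 * (prob D1 + prob D2)" if "A \<in> sets (S \<Otimes>\<^sub>M T)" for A
  proof -
    have "\<bar>measure ?L A - measure (distr P (S \<Otimes>\<^sub>M T) (\<lambda>\<omega>. (X' \<omega>, Y' \<omega>))) A\<bar> \<le> prob (D1 \<union> D2)"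
      using X Y X' Y' D eqX eqY that
      by (intro coupling_inequality) (auto intro: prob_space_axioms)
    moreover have "\<bar>measure ?R A - measure (distr P (S \<Otimes>\<^sub>M T) (\<lambda>\<omega>. (X' \<omega>, Y' \<omega>))) A\<bar>
        \<le> measure (P \<Otimes>\<^sub>M P) E"
      unfolding R joint
    proof (rule coupling_inequality[OF PP.prob_space_axioms _ _ E _ that])
      fix z assume "z \<in> space (P \<Otimes>\<^sub>M P) - E"
      then show "(case z of (a, b) \<Rightarrow> (X a, Y b)) = (case z of (a, b) \<Rightarrow> (X' a, Y' b))"
        using eqX[of "fst z"] eqY[of "snd z"] by (cases z) (auto simp: E_def space_pair_measure)
    qed (use X Y X' Y' in \<open>auto simp: split_beta\<close>)
    \<comment> \<open>Triangle inequality through the law of \<open>(X', Y')\<close>. This costs one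
      factor 2; the other one in the final 4 comes from the variation norm being twice the supremum
      over events.\<close>
    moreover have "\<bar>l - r\<bar> \<le> 2 * s"
      if "\<bar>l - j\<bar> \<le> p" "\<bar>r - j\<bar> \<le> q" "p \<le> s" "q \<le> s" for l r j p q s :: real
      using that by linarith
    ultimately show ?thesis
      using E_le D_le by blast
  qed
  then have "(SUP A \<in> sets ?L. \<bar>measure ?L A - measure ?R A\<bar>) \<le> 2 * (prob D1 + prob D2)"
    by (intro cSUP_least) (auto intro: sets.empty_sets)
  moreover have "variation_norm_diff ?L ?R = 2 * (SUP A \<in> sets ?L. \<bar>measure ?L A - measure ?R A\<bar>)"
  proof (rule variation_norm_diff_eq)
    show "prob_space ?L" using X Y by (intro prob_space_distr) auto
    show "prob_space ?R"
      unfolding R using X Y by (intro PP.prob_space_distr) (auto simp: split_beta)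
    show "sets ?R = sets ?L" by (simp add: R)
  qed
  ultimately show ?thesis by linarith
qed

lemma variation_norm_diff_nonneg:
  assumes "prob_space P" "prob_space Q" "sets Q = sets P"
  shows "0 \<le> variation_norm_diff P Q"
proof -
  interpret P: prob_space P by fact
  interpret Q: prob_space Q by fact
  have "\<bar>measure P A - measure Q A\<bar> \<le> 1" for A
    using P.prob_le_1[of A] Q.prob_le_1[of A] measure_nonneg[of P A] measure_nonneg[of Q A]
    by linarith
  then have "\<bar>measure P {} - measure Q {}\<bar> \<le> (SUP A \<in> sets P. \<bar>measure P A - measure Q A\<bar>)"
    by (intro cSUP_upper bdd_aboveI2[of _ _ 1]) auto
  then show ?thesis
    by (simp add: variation_norm_diff_eq[OF assms])
qed

section \<open>Restricted fields as random continuous functions\<close>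

lemma measurable_restrict_cont_space:
  assumes "\<And>x. x \<in> T \<Longrightarrow> (\<lambda>\<omega>. \<xi> \<omega> x) \<in> borel_measurable P"
    and "\<And>\<omega>. \<omega> \<in> space P \<Longrightarrow> continuous_on T (\<xi> \<omega>)"
  shows "(\<lambda>\<omega>. restrict (\<xi> \<omega>) T) \<in> measurable P (cont_space T)"
  unfolding cont_space_def
proof (rule measurable_restrict_space2)
  show "(\<lambda>\<omega>. restrict (\<xi> \<omega>) T) \<in> space P \<rightarrow> {f. continuous_on T f}"
    using assms(2) by (auto cong: continuous_on_cong)
  show "(\<lambda>\<omega>. restrict (\<xi> \<omega>) T) \<in> measurable P (Pi\<^sub>M T (\<lambda>_. borel))"
    using assms(1) by (rule measurable_restrict)
qed

lemma restrict_measurable_cont_space: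
  assumes "T \<subseteq> T'"
  shows "(\<lambda>f. restrict f T) \<in> measurable (cont_space T') (cont_space T)"
  unfolding cont_space_def
proof (rule measurable_restrict_space3)
  show "(\<lambda>f. restrict f T) \<in> {f. continuous_on T' f} \<rightarrow> {f. continuous_on T f}"
    using assms by (auto cong: continuous_on_cong intro: continuous_on_subset)
qed (rule measurable_restrict_subset[OF assms])

text \<open>The two successive image measures collapse into the image under the pair of
  restrictions, the form to which the coupling estimate applies.\<close>

lemma abs_reg_coeff_eq:
  assumes "\<And>x. (\<lambda>\<omega>. \<xi> \<omega> x) \<in> borel_measurable P"
    and "\<And>\<omega>. \<omega> \<in> space P \<Longrightarrow> continuous_on UNIV (\<xi> \<omega>)"
  shows "abs_reg_coeff P \<xi> T1 T2 =
    variation_norm_diff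
      (distr P (cont_space T1 \<Otimes>\<^sub>M cont_space T2) (\<lambda>\<omega>. (restrict (\<xi> \<omega>) T1, restrict (\<xi> \<omega>) T2)))
      (distr P (cont_space T1) (\<lambda>\<omega>. restrict (\<xi> \<omega>) T1)
        \<Otimes>\<^sub>M distr P (cont_space T2) (\<lambda>\<omega>. restrict (\<xi> \<omega>) T2))"
proof -
  have "(\<lambda>\<omega>. restrict (\<xi> \<omega>) (T1 \<union> T2)) \<in> measurable P (cont_space (T1 \<union> T2))"
    using assms by (intro measurable_restrict_cont_space) (auto intro: continuous_on_subset)
  moreover have "(\<lambda>f. (restrict f T1, restrict f T2))
      \<in> measurable (cont_space (T1 \<union> T2)) (cont_space T1 \<Otimes>\<^sub>M cont_space T2)"
    by (intro measurable_Pair restrict_measurable_cont_space) auto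
  ultimately show ?thesis
    by (simp add: abs_reg_coeff_def field_law_def distr_distr comp_def Int_absorb2 Int_commute
        restrict_restrict)
qed

section \<open>Deterministic geometry of the crystals\<close>

lemma continuous_on_INF_finite:
  fixes f :: "'a \<Rightarrow> 'b::topological_space \<Rightarrow> real"
  assumes "finite S" "S \<noteq> {}" "\<And>g. g \<in> S \<Longrightarrow> continuous_on T (f g)"
  shows "continuous_on T (\<lambda>x. INF g\<in>S. f g x)"
  using assms
proof (induction S rule: finite_ne_induct)
  case (insert g S)
  have "(INF h\<in>insert g S. f h x) = min (f g x) (INF h\<in>S. f h x)" for x
    using insert.hyps by (subst cINF_insert) (auto simp: inf_min)
  then show ?case
    using insert by (auto intro!: continuous_on_min)
qed simp

text \<open>The deterministic setting. The condition \<open>speed\<close> bounds the growth speed of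
  every crystal by \<open>M\<close>, and the two \<open>overtake\<close> conditions say that a germ
  beaten at a point on one side of its location stays beaten further out on that side.\<close>

locale crystal_family =
  fixes A :: "real \<times> real \<Rightarrow> real \<Rightarrow> real" and M :: real
  assumes M_pos: "M > 0"
    and translate: "\<And>g x. g \<in> germs \<Longrightarrow> A g x = A (0, snd g) (x - fst g)"
    and at_location: "\<And>g. g \<in> germs \<Longrightarrow> A g (fst g) = snd g"
    and cont: "\<And>g. g \<in> germs \<Longrightarrow> continuous_on UNIV (A g)"
    and speed: "\<And>tg x. tg \<ge> 0 \<Longrightarrow> A (0, tg) x \<ge> tg + 1 / M * \<bar>x\<bar>"
    and overtake_right: "\<And>g1 g2 x0 x. g1 \<in> germs \<Longrightarrow> g2 \<in> germs \<Longrightarrow> x0 \<ge> fst g1 \<Longrightarrow>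
                A g1 x0 \<ge> A g2 x0 \<Longrightarrow> x \<ge> x0 \<Longrightarrow> A g1 x \<ge> A g2 x"
    and overtake_left: "\<And>g1 g2 x1 x. g1 \<in> germs \<Longrightarrow> g2 \<in> germs \<Longrightarrow> x1 \<le> fst g1 \<Longrightarrow>
                A g1 x1 \<ge> A g2 x1 \<Longrightarrow> x \<le> x1 \<Longrightarrow> A g1 x \<ge> A g2 x"
begin

lemma arrival_ge:
  assumes "g \<in> germs" shows "A g x \<ge> snd g + \<bar>x - fst g\<bar> / M"
proof -
  have "snd g \<ge> 0" using assms by (auto simp: germs_def)
  then show ?thesis
    using speed[of "snd g" "x - fst g"] by (subst translate[OF assms]) simp
qed

lemma arrival_nonneg: "g \<in> germs \<Longrightarrow> A g x \<ge> 0"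
  using arrival_ge[of g x] M_pos by (auto simp: germs_def intro: order_trans[rotated])

lemma distance_le:
  assumes "g \<in> germs" "A g x \<le> t" shows "\<bar>x - fst g\<bar> + M * snd g \<le> M * t"
proof -
  have "snd g + \<bar>x - fst g\<bar> / M \<le> t"
    using arrival_ge[OF assms(1), of x] assms(2) by linarith
  then have "M * (snd g + \<bar>x - fst g\<bar> / M) \<le> M * t"
    using M_pos by (intro mult_left_mono) auto
  then show ?thesis using M_pos by (simp add: algebra_simps)
qed

lemma bdd_below_arrival: "S \<subseteq> germs \<Longrightarrow> bdd_below ((\<lambda>g. A g x) ` S)"
  using arrival_nonneg by (intro bdd_belowI2[of _ 0]) blast

text \<open>Two germs at the same location: apply 7a) at the common location in both directions.\<close>

lemma arrival_mono_birth:
  assumes "0 \<le> s" "s \<le> s'" shows "A (u, s) x \<le> A (u, s') x"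
proof -
  have g: "(u, s) \<in> germs" "(u, s') \<in> germs" using assms by (auto simp: germs_def)
  have "A (u, s) u \<le> A (u, s') u"
    using at_location[OF g(1)] at_location[OF g(2)] assms by simp
  then show ?thesis
    using overtake_right[OF g(2,1), of u x] overtake_left[OF g(2,1), of u x]
    by (cases "x \<ge> u") auto
qed

text \<open>Bounded speed confines such germs to a space-time rectangle. This is what lets local
  finiteness of the process produce finite infima and makes causal cones admissible test
  sets.\<close>

lemma bounded_arrivals:
  "bounded {g \<in> germs. \<exists>x. \<bar>x\<bar> \<le> R \<and> A g x \<le> t}"
proof (rule bounded_subset)
  show "bounded ({-(R + M * t)..R + M * t} \<times> {0..t})"
    by (intro bounded_Times) auto
  show "{g \<in> germs. \<exists>x. \<bar>x\<bar> \<le> R \<and> A g x \<le> t} \<subseteq> {-(R + M * t)..R + M * t} \<times> {0..t}"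
  proof
    fix g assume "g \<in> {g \<in> germs. \<exists>x. \<bar>x\<bar> \<le> R \<and> A g x \<le> t}"
    then obtain x where g: "g \<in> germs" and x: "\<bar>x\<bar> \<le> R" "A g x \<le> t" by auto
    have snd: "snd g \<ge> 0" using g by (auto simp: germs_def)
    have *: "\<bar>x - fst g\<bar> + M * snd g \<le> M * t" by (rule distance_le[OF g x(2)])
    moreover have "M * snd g \<ge> 0" using snd M_pos by simp
    moreover from * have "M * snd g \<le> M * t" by linarith
    then have "snd g \<le> t" using M_pos by simp
    ultimately show "g \<in> {-(R + M * t)..R + M * t} \<times> {0..t}"
      using snd x(1) by (cases g) auto
  qed
qed

lemma bounded_cone: "bounded {g \<in> germs. A g x \<le> t}"
  by (rule bounded_subset[OF bounded_arrivals[of "\<bar>x\<bar>" t]]) auto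

text \<open>Dropping germs that are beaten at \<open>x\<close> by a retained germ leaves the infimum
  unchanged. Nonemptiness of \<open>S'\<close> and nonnegative arrival times keep the real infima
  meaningful.\<close>

lemma INF_eq_of_dominating:
  assumes "S \<subseteq> germs" "S' \<subseteq> S" "S' \<noteq> {}" "\<And>g. g \<in> S \<Longrightarrow> \<exists>g'\<in>S'. A g' x \<le> A g x"
  shows "(INF g\<in>S. A g x) = (INF g\<in>S'. A g x)"
proof (rule antisym)
  show "(INF g\<in>S. A g x) \<le> (INF g\<in>S'. A g x)"
    using assms by (intro cINF_superset_mono bdd_below_arrival) auto
  show "(INF g\<in>S'. A g x) \<le> (INF g\<in>S. A g x)"
    using assms by (intro cINF_mono bdd_below_arrival) auto
qed

text \<open>Near any point, one fixed germ \<open>g0\<close> covers the window by some time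
  \<open>a\<close>; only germs that arrive in the window by then matter, and these are finitely
  many. For empty \<open>S\<close> the infimum is a constant.\<close>

lemma continuous_INF:
  assumes S: "S \<subseteq> germs" and fin: "\<And>B. bounded B \<Longrightarrow> finite (S \<inter> B)"
  shows "continuous_on UNIV (\<lambda>x. INF g\<in>S. A g x)"
proof (cases "S = {}")
  case True
  then show ?thesis by simp
next
  case False
  then obtain g0 where g0: "g0 \<in> S" by auto
  have "isCont (\<lambda>x. INF g\<in>S. A g x) z" for z
  proof -
    \<comment> \<open>The margin 1 puts \<open>z\<close> in the interior of the window and makes
      \<open>R\<close> positive, so that the window contains 0.\<close>
    define R where "R = \<bar>z\<bar> + 1"
    have "compact (A g0 ` {-R..R})"
      using cont[of g0] g0 S by (intro compact_continuous_image) (auto intro: continuous_on_subset)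
    then obtain a where a: "\<And>x. x \<in> {-R..R} \<Longrightarrow> A g0 x \<le> a"
      using compact_imp_bounded bounded_imp_bdd_above bdd_above_def
      by (metis imageI)
    define S0 where "S0 = S \<inter> {g \<in> germs. \<exists>x. \<bar>x\<bar> \<le> R \<and> A g x \<le> a}"
    have "finite S0"
      unfolding S0_def by (intro fin bounded_arrivals)
    moreover have g0_in: "g0 \<in> S0"
    proof -
      have "\<bar>0\<bar> \<le> R \<and> A g0 0 \<le> a" using a[of 0] by (auto simp: R_def)
      then show ?thesis unfolding S0_def using g0 S by blast
    qed
    ultimately have "continuous_on {-R<..<R} (\<lambda>x. INF g\<in>S0. A g x)"
      using S by (intro continuous_on_INF_finite) (auto simp: S0_def intro: continuous_on_subset[OF cont])
    moreover have "(INF g\<in>S. A g x) = (INF g\<in>S0. A g x)" if x: "x \<in> {-R<..<R}" for x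
    proof (rule INF_eq_of_dominating[OF S])
      fix g assume g: "g \<in> S"
      show "\<exists>g'\<in>S0. A g' x \<le> A g x"
      proof (cases "A g x \<le> a")
        case True
        then have "g \<in> S0" using g S x by (auto simp: S0_def intro!: exI[of _ x])
        then show ?thesis by auto
      next
        case False
        then have "A g0 x \<le> A g x" using a[of x] x by auto
        with g0_in show ?thesis by auto
      qed
    qed (use g0_in in \<open>auto simp: S0_def\<close>)
    ultimately have "continuous_on {-R<..<R} (\<lambda>x. INF g\<in>S. A g x)"
      by (subst continuous_on_cong[OF refl]) auto
    moreover have "z \<in> {-R<..<R}" by (auto simp: R_def)
    ultimately show ?thesis
      by (simp add: continuous_on_eq_continuous_at)
  qed
  then show ?thesis by (simp add: continuous_on_eq_continuous_at)
qed

text \<open>A germ at or beyond \<open>c\<close> needs time at least \<open>c / M\<close> to reach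
  0, and \<open>g0\<close> is there by that time. Being beaten at 0, such a germ is beaten on the
  whole negative half-line.\<close>

lemma INF_left_determined:
  assumes S: "S \<subseteq> germs" and g0: "g0 \<in> S" "fst g0 < c" "M * A g0 0 \<le> c" and x: "x \<le> 0"
  shows "(INF g\<in>S. A g x) = (INF g\<in>{g \<in> S. fst g < c}. A g x)"
proof -
  have nonempty: "{g \<in> S. fst g < c} \<noteq> {}" using g0 by blast
  show ?thesis
  proof (rule INF_eq_of_dominating[OF S _ nonempty])
    fix g assume g: "g \<in> S"
    show "\<exists>g'\<in>{g \<in> S. fst g < c}. A g' x \<le> A g x"
    proof (cases "fst g < c")
      case False
      have gg: "g \<in> germs" "g0 \<in> germs" using g g0 S by auto
      \<comment> \<open>The resulting \<open>c \<ge> 0\<close> places 0 to the left of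
        \<open>g\<close>, the side condition of \<open>overtake_left\<close>.\<close>
      have "A g0 0 \<ge> 0" by (rule arrival_nonneg[OF gg(2)])
      then have c: "c \<ge> 0" using g0(3) M_pos mult_nonneg_nonneg[of M "A g0 0"] by linarith
      have "c \<le> \<bar>0 - fst g\<bar>" using False by auto
      moreover have "M * snd g \<ge> 0" using gg M_pos by (auto simp: germs_def)
      ultimately have "M * A g0 0 \<le> M * A g 0"
        using distance_le[OF gg(1) order_refl, of 0] g0(3) by linarith
      then have "A g0 0 \<le> A g 0" using M_pos by simp
      then have "A g0 x \<le> A g x"
        using overtake_left[OF gg, of 0 x] x False c by auto
      then show ?thesis using g0 by (intro bexI[of _ g0]) auto
    qed (use g in blast)
  qed auto
qed

text \<open>Mirror image with base point \<open>y\<close>. The line at \<open>c\<close> now belongs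
  to the retained side, so the two retained half-planes are complementary.\<close>

lemma INF_right_determined:
  assumes S: "S \<subseteq> germs" and g0: "g0 \<in> S" "fst g0 \<ge> c" "M * A g0 y \<le> y - c" and x: "x \<ge> y"
  shows "(INF g\<in>S. A g x) = (INF g\<in>{g \<in> S. fst g \<ge> c}. A g x)"
proof -
  have nonempty: "{g \<in> S. fst g \<ge> c} \<noteq> {}" using g0 by blast
  show ?thesis
  proof (rule INF_eq_of_dominating[OF S _ nonempty])
    fix g assume g: "g \<in> S"
    show "\<exists>g'\<in>{g \<in> S. fst g \<ge> c}. A g' x \<le> A g x"
    proof (cases "fst g \<ge> c")
      case False
      have gg: "g \<in> germs" "g0 \<in> germs" using g g0 S by auto
      have "A g0 y \<ge> 0" by (rule arrival_nonneg[OF gg(2)])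
      then have c: "y \<ge> c" using g0(3) M_pos mult_nonneg_nonneg[of M "A g0 y"] by linarith
      have "y - c \<le> \<bar>y - fst g\<bar>" using False by auto
      moreover have "M * snd g \<ge> 0" using gg M_pos by (auto simp: germs_def)
      ultimately have "M * A g0 y \<le> M * A g y"
        using distance_le[OF gg(1) order_refl, of y] g0(3) by linarith
      then have "A g0 y \<le> A g y" using M_pos by simp
      then have "A g0 x \<le> A g x"
        using overtake_right[OF gg, of y x] x False c by auto
      then show ?thesis using g0 by (intro bexI[of _ g0]) auto
    qed (use g in blast)
  qed auto
qed

end

section \<open>Intensity and measurability of the causal cones\<close>

locale poisson_crystal_process = crystal_family A M + prob_space P
  for A :: "real \<times> real \<Rightarrow> real \<Rightarrow> real" and M :: real and P :: "'w measure" +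
  fixes m :: "real measure" and \<Lambda> :: "(real \<times> real) measure" and N :: "'w \<Rightarrow> (real \<times> real) set"
  assumes m_sets: "sets m = sets (restrict_space borel {0..})"
    and m_finite: "\<And>a. a > 0 \<Longrightarrow> emeasure m {0..a} < \<infinity>"
    and intensity: "\<Lambda> = lborel \<Otimes>\<^sub>M m"
    and poisson: "poisson_process P \<Lambda> N"
begin

lemma space_m: "space m = {0..}"
  using sets_eq_imp_space_eq[OF m_sets] by (simp add: space_restrict_space)

lemma sets_mI: "S \<in> sets borel \<Longrightarrow> S \<subseteq> {0..} \<Longrightarrow> S \<in> sets m"
  unfolding m_sets by (subst sets_restrict_space_iff) auto

lemma sigma_finite_m: "sigma_finite_measure m"
proof
  have "{0..real n + 1} \<in> sets m \<and> emeasure m {0..real n + 1} \<noteq> \<infinity>" for n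
    using m_finite[of "real n + 1"] by (auto intro!: sets_mI)
  moreover have "(\<Union>n. {0..real n + 1}) = {0..}"
  proof (safe, simp)
    fix x :: real assume "x \<ge> 0"
    moreover obtain n where "x \<le> real n" using real_arch_simple by blast
    ultimately show "x \<in> (\<Union>n. {0..real n + 1})" by (auto intro!: exI[of _ n])
  qed
  ultimately show "\<exists>C. countable C \<and> C \<subseteq> sets m \<and> \<Union>C = space m \<and> (\<forall>a\<in>C. emeasure m a \<noteq> \<infinity>)"
    by (intro exI[of _ "range (\<lambda>n. {0..real n + 1})"]) (auto simp: space_m)
qed

lemma pair_sigma_finite_intensity: "pair_sigma_finite lborel m"
  unfolding pair_sigma_finite_def using sigma_finite_m lborel.sigma_finite_measure_axioms by blast

lemma space_intensity: "space \<Lambda> = germs"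
  by (simp add: intensity space_pair_measure space_m germs_def)

lemma Times_sets: "I \<in> sets borel \<Longrightarrow> S \<in> sets borel \<Longrightarrow> S \<subseteq> {0..} \<Longrightarrow> I \<times> S \<in> sets \<Lambda>"
  unfolding intensity by (intro pair_measureI sets_mI) auto

lemma emeasure_window:
  "emeasure \<Lambda> ({-R..R} \<times> {0..a}) = emeasure lborel {-R..R} * emeasure m {0..a}"
  unfolding intensity
  by (subst sigma_finite_measure.emeasure_pair_measure_Times[OF sigma_finite_m])
    (auto intro!: sets_mI)

text \<open>A bounded set of germs fits into a window whose base has finite length and whose birth
  times have finite \<open>m\<close>-mass.\<close>

lemma bounded_finite_intensity:
  assumes "B \<in> sets \<Lambda>" "bounded B" shows "emeasure \<Lambda> B \<noteq> \<infinity>"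
proof -
  obtain R where R: "\<And>g. g \<in> B \<Longrightarrow> norm g \<le> R" "R > 0"
    using assms(2) by (auto simp: bounded_pos)
  have "B \<subseteq> {-R..R} \<times> {0..R}"
  proof
    fix g assume g: "g \<in> B"
    then have "g \<in> germs" using sets.sets_into_space[OF assms(1)] space_intensity by auto
    then have "snd g \<ge> 0" by (auto simp: germs_def)
    moreover have "\<bar>fst g\<bar> \<le> R" "\<bar>snd g\<bar> \<le> R"
      using R(1)[OF g] norm_fst_le[of "fst g" "snd g"] norm_snd_le[of "snd g" "fst g"] by auto
    ultimately show "g \<in> {-R..R} \<times> {0..R}" by (cases g) auto
  qed
  then have "emeasure \<Lambda> B \<le> emeasure \<Lambda> ({-R..R} \<times> {0..R})"
    by (intro emeasure_mono Times_sets) auto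
  also have "\<dots> < \<infinity>"
    unfolding emeasure_window using m_finite[OF R(2)] R(2) by (simp add: ennreal_mult_less_top)
  finally show ?thesis by simp
qed

text \<open>An arrival time is continuous in the location and monotone in the birth time of the germ.\<close>

lemma arrival_lt_sets: "{g \<in> germs. A g x < a} \<in> sets \<Lambda>"
proof -
  \<comment> \<open>Continuity in the location allows a cover by strips over rational intervals.
    Monotonicity in the birth time makes each \<open>S p q\<close> an interval, hence Borel.\<close>
  define S where "S p q = {s. s \<ge> 0 \<and> (\<forall>u\<in>{p<..<q}. A (u, s) x < a)}" for p q
  have "is_interval (S p q)" for p q
    unfolding is_interval_1
  proof (intro ballI allI impI, elim conjE)
    fix s s' b assume "s \<in> S p q" "s' \<in> S p q" "s \<le> b" "b \<le> s'"
    moreover from this have "b \<ge> 0" by (simp add: S_def)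
    moreover have "A (u, b) x < a" if "u \<in> {p<..<q}" for u
      using calculation that
      by (intro le_less_trans[OF arrival_mono_birth[of b s' u x]]) (auto simp: S_def)
    ultimately show "b \<in> S p q" by (simp add: S_def)
  qed
  then have S: "S p q \<in> sets borel" for p q
    by (rule real_interval_borel_measurable)
  have S_nonneg: "S p q \<subseteq> {0..}" for p q
    by (auto simp: S_def)
  have "{g \<in> germs. A g x < a} = (\<Union>p\<in>\<rat>. \<Union>q\<in>\<rat>. {p<..<q} \<times> S p q)"
  proof (intro equalityI subsetI)
    fix g assume "g \<in> {g \<in> germs. A g x < a}"
    then obtain u s where us: "g = (u, s)" and g: "(u, s) \<in> germs" and lt: "A (u, s) x < a"
      by (cases g) auto
    have s: "s \<ge> 0" using g by (simp add: germs_def)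
    have s0: "(0, s) \<in> germs" using s by (simp add: germs_def)
    have eq: "(\<lambda>v. A (v, s) x) = (\<lambda>v. A (0, s) (x - v))"
    proof
      show "A (v, s) x = A (0, s) (x - v)" for v
        using s by (subst translate) (auto simp: germs_def)
    qed
    have "continuous_on UNIV (\<lambda>v. A (v, s) x)"
      unfolding eq by (intro continuous_on_compose2[OF cont[OF s0]] continuous_intros) auto
    then have "open ((\<lambda>v. A (v, s) x) -` {..<a})"
      using open_vimage open_lessThan by blast
    then obtain e where e: "e > 0" "ball u e \<subseteq> (\<lambda>v. A (v, s) x) -` {..<a}"
      using lt open_contains_ball by (metis (no_types, lifting) lessThan_iff vimageI)
    obtain p where p: "p \<in> \<rat>" "u - e < p" "p < u"
      using Rats_dense_in_real[of "u - e" u] e(1) by auto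
    obtain q where q: "q \<in> \<rat>" "u < q" "q < u + e"
      using Rats_dense_in_real[of u "u + e"] e(1) by auto
    have "{p<..<q} \<subseteq> ball u e"
      using p q by (auto simp: dist_real_def)
    then have "s \<in> S p q" using e(2) s by (auto simp: S_def)
    then show "g \<in> (\<Union>p\<in>\<rat>. \<Union>q\<in>\<rat>. {p<..<q} \<times> S p q)"
      unfolding us using p q by auto
  next
    fix g assume "g \<in> (\<Union>p\<in>\<rat>. \<Union>q\<in>\<rat>. {p<..<q} \<times> S p q)"
    then show "g \<in> {g \<in> germs. A g x < a}"
      by (cases g) (auto simp: S_def germs_def)
  qed
  also have "\<dots> \<in> sets \<Lambda>"
  proof (intro sets.countable_UN' countable_rat image_subsetI)
    show "{p<..<q} \<times> S p q \<in> sets \<Lambda>" for p q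
      by (intro Times_sets S S_nonneg) auto
  qed
  finally show ?thesis .
qed

lemma arrival_measurable: "(\<lambda>g. A g x) \<in> borel_measurable \<Lambda>"
  using arrival_lt_sets unfolding borel_measurable_iff_less space_intensity by blast

lemma location_measurable: "fst \<in> borel_measurable \<Lambda>"
  unfolding intensity by simp

lemma cone_sets:
  assumes "H \<in> sets borel" shows "{g \<in> germs. A g x \<le> t \<and> fst g \<in> H} \<in> sets \<Lambda>"
proof -
  have "{g \<in> space \<Lambda>. A g x \<le> t} \<in> sets \<Lambda>"
    using borel_measurable_iff_le[of "\<lambda>g. A g x" \<Lambda>] arrival_measurable by blast
  moreover have "fst -` H \<inter> space \<Lambda> \<in> sets \<Lambda>"
    by (rule measurable_sets[OF location_measurable assms])
  moreover have "{g \<in> germs. A g x \<le> t \<and> fst g \<in> H} = {g \<in> space \<Lambda>. A g x \<le> t} \<inter> (fst -` H \<inter> space \<Lambda>)"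
    by (auto simp: space_intensity)
  ultimately show ?thesis by simp
qed

text \<open>At a fixed birth time the arrival depends only on \<open>x - u\<close>, so the slices
  for \<open>x\<close> and for 0 are translates and Lebesgue measure does not distinguish
  them.\<close>

lemma cone_slice_translate:
  assumes "s \<ge> 0" and S: "{u. A (u, s) 0 \<le> t} \<in> sets borel"
  shows "emeasure lborel {u. A (u, s) x \<le> t} = emeasure lborel {u. A (u, s) 0 \<le> t}"
proof -
  have eq: "A (v, s) y = A (0, s) (y - v)" for v y
    using assms by (subst translate) (auto simp: germs_def)
  have "emeasure lborel {u. A (u, s) 0 \<le> t}
      = emeasure (distr lborel borel ((+) (-x))) {u. A (u, s) 0 \<le> t}"
    by (simp only: lborel_distr_plus)
  also have "\<dots> = emeasure lborel ((+) (-x) -` {u. A (u, s) 0 \<le> t})"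
    using S by (subst emeasure_distr) auto
  also have "(+) (-x) -` {u. A (u, s) 0 \<le> t} = {u. A (u, s) x \<le> t}"
  proof -
    have "A (- x + u, s) 0 = A (u, s) x" for u
      using eq[of "- x + u" 0] eq[of u x] by simp
    then show ?thesis by simp
  qed
  finally show ?thesis by simp
qed

text \<open>Integrate the equal slice lengths over the birth times. The cone at the far endpoint
  \<open>r\<close> thus has the same intensity as the cone at 0.\<close>

lemma cone_measure_translate:
  "measure \<Lambda> {g \<in> germs. A g x \<le> t} = measure \<Lambda> (causal_cone A t)"
proof -
  interpret pair_sigma_finite lborel m by (rule pair_sigma_finite_intensity)
  have sets: "{g \<in> germs. A g y \<le> t} \<in> sets (lborel \<Otimes>\<^sub>M m)" for y
    using cone_sets[of UNIV y t] by (simp add: intensity)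
  have "emeasure lborel ((\<lambda>u. (u, s)) -` {g \<in> germs. A g x \<le> t})
      = emeasure lborel ((\<lambda>u. (u, s)) -` {g \<in> germs. A g 0 \<le> t})" if "s \<in> space m" for s
  proof -
    have s: "s \<ge> 0" using that by (simp add: space_m)
    then have sl: "(\<lambda>u. (u, s)) -` {g \<in> germs. A g y \<le> t} = {u. A (u, s) y \<le> t}" for y
      by (auto simp: germs_def)
    show ?thesis
      using sets_Pair2[OF sets, of s 0] s unfolding sl by (intro cone_slice_translate) auto
  qed
  then have "emeasure (lborel \<Otimes>\<^sub>M m) {g \<in> germs. A g x \<le> t}
      = emeasure (lborel \<Otimes>\<^sub>M m) {g \<in> germs. A g 0 \<le> t}"
    by (simp add: emeasure_pair_measure_alt2[OF sets] cong: nn_integral_cong)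
  then show ?thesis by (simp add: measure_def causal_cone_def intensity)
qed

lemma cone_right_of_in:
  assumes "M * t \<le> y - c" "g \<in> germs" "A g y \<le> t" shows "c \<le> fst g"
proof -
  have "M * snd g \<ge> 0" using assms(2) M_pos by (auto simp: germs_def)
  then show ?thesis using distance_le[OF assms(2,3)] assms(1) by linarith
qed

lemma cone_left_of_in:
  assumes "M * t \<le> c - y" "g \<in> germs" "A g y \<le> t" shows "fst g \<le> c"
proof -
  have "M * snd g \<ge> 0" using assms(2) M_pos by (auto simp: germs_def)
  then show ?thesis using distance_le[OF assms(2,3)] assms(1) by linarith
qed

lemma vertical_line_null: "{c} \<times> {0..} \<in> null_sets \<Lambda>"
proof -
  have "{c} \<times> {0..} \<in> sets \<Lambda>" by (intro Times_sets) auto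
  moreover have "emeasure \<Lambda> ({c} \<times> {0..}) = 0"
    unfolding intensity
    by (subst sigma_finite_measure.emeasure_pair_measure_Times[OF sigma_finite_m])
      (auto intro!: sets_mI)
  ultimately show ?thesis by auto
qed

text \<open>By bounded speed the cone does not extend beyond \<open>c\<close>, so trimming removes
  at most germs located exactly at \<open>c\<close>, a null set.\<close>

lemma cone_measure_trim:
  assumes "M * t \<le> c"
  shows "measure \<Lambda> {g \<in> germs. A g 0 \<le> t \<and> fst g < c} = measure \<Lambda> (causal_cone A t)"
proof -
  have K: "causal_cone A t \<in> sets \<Lambda>"
    using cone_sets[of UNIV 0 t] by (simp add: causal_cone_def)
  have "{g \<in> germs. A g 0 \<le> t \<and> fst g < c} = causal_cone A t - {c} \<times> {0..}"
    using cone_left_of_in[of t c 0] assms by (fastforce simp: causal_cone_def germs_def)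
  then show ?thesis
    using emeasure_Diff_null_set[OF vertical_line_null K] by (simp add: measure_def)
qed

section \<open>One-sided fields as functions of void events\<close>

text \<open>If there are germs over \<open>H\<close>, the field at \<open>x\<close> is below
  \<open>a\<close> exactly when one of them arrives before \<open>a\<close>, the complement of a
  void event. The absence of germs over \<open>H\<close> is a void event as well.\<close>

lemma field_measurable_void:
  fixes H :: "real set"
  assumes H: "H \<in> sets borel"
  shows "(\<lambda>\<omega>. INF g\<in>{g \<in> N \<omega>. fst g \<in> H}. A g x)
    \<in> borel_measurable (sigma (space P) (void_events P \<Lambda> N (H \<times> UNIV)))"
    (is "?\<xi> \<in> borel_measurable ?\<G>")
proof (rule borel_measurableI_less)
  fix a :: real
  have sub: "N \<omega> \<subseteq> germs" if "\<omega> \<in> space P" for \<omega>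
    using poisson that by (auto simp: poisson_process_def space_intensity)
  have space: "space ?\<G> = space P"
    by (intro space_measure_of) (auto simp: void_events_def)
  have H_sets: "fst -` H \<inter> space \<Lambda> \<in> sets \<Lambda>"
    by (rule measurable_sets[OF location_measurable H])
  \<comment> \<open>\<open>B\<close> lies in a causal cone and is therefore bounded. The constant
    union over \<open>n\<close> below only matches the form of
    \<open>void_UN_in_sigma\<close>.\<close>
  define B where "B = {g \<in> germs. A g x < a} \<inter> (fst -` H \<inter> space \<Lambda>)"
  have "B \<in> sets \<Lambda>" unfolding B_def using arrival_lt_sets H_sets by blast
  moreover have "bounded B"
    by (rule bounded_subset[OF bounded_cone[of x a]]) (auto simp: B_def)
  ultimately have hit: "{\<omega> \<in> space P. N \<omega> \<inter> (\<Union>n::nat. B) = {}} \<in> sets ?\<G>"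
    by (intro void_UN_in_sigma) (auto simp: B_def)
  \<comment> \<open>Bounded windows exhausting all germs over \<open>H\<close>, needed because that
    region may be unbounded.\<close>
  define C where "C n = ({-real n..real n} \<times> {0..real n}) \<inter> (fst -` H \<inter> space \<Lambda>)" for n
  have "C n \<in> sets \<Lambda>" for n
    unfolding C_def by (intro sets.Int[OF Times_sets H_sets]) auto
  moreover have "bounded (C n)" for n
    by (rule bounded_subset[of "{-real n..real n} \<times> {0..real n}"])
      (auto simp: C_def intro: bounded_Times)
  ultimately have empty: "{\<omega> \<in> space P. N \<omega> \<inter> (\<Union>n. C n) = {}} \<in> sets ?\<G>"
    by (intro void_UN_in_sigma) (auto simp: C_def)
  have "(\<Union>n. C n) = fst -` H \<inter> germs"
  proof safe
    fix u s assume us: "(u, s) \<in> germs" "fst (u, s) \<in> H"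
    obtain n where "max \<bar>u\<bar> s \<le> real n" using real_arch_simple by blast
    then have "(u, s) \<in> C n" using us by (auto simp: C_def germs_def space_intensity)
    then show "(u, s) \<in> (\<Union>n. C n)" by blast
  qed (auto simp: C_def space_intensity)
  then have empty_iff: "N \<omega> \<inter> (\<Union>n. C n) = {} \<longleftrightarrow> {g \<in> N \<omega>. fst g \<in> H} = {}" if "\<omega> \<in> space P" for \<omega>
    using sub[OF that] by auto
  have hit_iff: "N \<omega> \<inter> B = {} \<longleftrightarrow> (\<forall>g\<in>{g \<in> N \<omega>. fst g \<in> H}. \<not> A g x < a)" if "\<omega> \<in> space P" for \<omega>
    using sub[OF that] by (auto simp: B_def space_intensity)
  \<comment> \<open>Without germs over \<open>H\<close> the field has the unspecified value
    \<open>Inf {}\<close>. Whether this is below \<open>a\<close> does not depend on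
    \<open>\<omega>\<close>, so the case contributes a void event or nothing.\<close>
  have lt: "?\<xi> \<omega> < a \<longleftrightarrow> (if {g \<in> N \<omega>. fst g \<in> H} = {} then Inf {} < a else N \<omega> \<inter> B \<noteq> {})"
    if \<omega>: "\<omega> \<in> space P" for \<omega>
  proof (cases "{g \<in> N \<omega>. fst g \<in> H} = {}")
    case True
    then show ?thesis unfolding True by simp
  next
    case False
    moreover have "bdd_below ((\<lambda>g. A g x) ` {g \<in> N \<omega>. fst g \<in> H})"
      using sub[OF \<omega>] by (intro bdd_below_arrival) auto
    ultimately show ?thesis
      using hit_iff[OF \<omega>] by (subst cINF_less_iff) auto
  qed
  have "{\<omega> \<in> space ?\<G>. ?\<xi> \<omega> < a} =
    {\<omega> \<in> space P. if N \<omega> \<inter> (\<Union>n. C n) = {} then Inf {} < a else N \<omega> \<inter> (\<Union>n::nat. B) \<noteq> {}}"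
    unfolding space
  proof (intro Collect_cong conj_cong refl)
    show "?\<xi> \<omega> < a \<longleftrightarrow>
      (if N \<omega> \<inter> (\<Union>n. C n) = {} then Inf {} < a else N \<omega> \<inter> (\<Union>n::nat. B) \<noteq> {})"
      if "\<omega> \<in> space P" for \<omega>
      using lt[OF that] by (simp only: empty_iff[OF that] UN_constant UNIV_not_empty if_False)
  qed
  also have "\<dots> = (if Inf {} < a then {\<omega> \<in> space P. N \<omega> \<inter> (\<Union>n. C n) = {}} else {})
      \<union> ((space ?\<G> - {\<omega> \<in> space P. N \<omega> \<inter> (\<Union>n::nat. B) = {}})
         - {\<omega> \<in> space P. N \<omega> \<inter> (\<Union>n. C n) = {}})"
    unfolding space by auto
  also have "\<dots> \<in> sets ?\<G>"
    using hit empty by auto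
  finally show "{\<omega> \<in> space ?\<G>. ?\<xi> \<omega> < a} \<in> sets ?\<G>" .
qed

lemma field_continuous:
  assumes "\<omega> \<in> space P"
  shows "continuous_on UNIV (\<lambda>x. INF g\<in>{g \<in> N \<omega>. fst g \<in> H}. A g x)"
proof (rule continuous_INF)
  show "{g \<in> N \<omega>. fst g \<in> H} \<subseteq> germs"
    using poisson assms by (auto simp: poisson_process_def space_intensity)
  show "finite ({g \<in> N \<omega>. fst g \<in> H} \<inter> B)" if "bounded B" for B
  proof (rule finite_subset)
    show "finite (N \<omega> \<inter> B)" using poisson assms that by (auto simp: poisson_process_def)
  qed auto
qed

lemma restricted_field_measurable_void:
  assumes "H \<in> sets borel"
  shows "(\<lambda>\<omega>. \<lambda>x\<in>T. INF g\<in>{g \<in> N \<omega>. fst g \<in> H}. A g x)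
    \<in> measurable (sigma (space P) (void_events P \<Lambda> N (H \<times> UNIV))) (cont_space T)"
proof -
  have "space (sigma (space P) (void_events P \<Lambda> N (H \<times> UNIV))) = space P"
    by (intro space_measure_of) (auto simp: void_events_def)
  then show ?thesis
    using field_continuous
    by (intro measurable_restrict_cont_space field_measurable_void assms)
      (auto intro: continuous_on_subset)
qed

lemma measurable_from_void:
  assumes "f \<in> measurable (sigma (space P) (void_events P \<Lambda> N H)) S"
  shows "f \<in> measurable P S"
proof -
  have "void_events P \<Lambda> N H \<subseteq> Pow (space P)" by (auto simp: void_events_def)
  moreover have "sigma_sets (space P) (void_events P \<Lambda> N H) \<subseteq> sets P"
    by (rule sets.sigma_sets_subset[OF void_events_sets[OF poisson]])
  ultimately show ?thesis
    using assms by (intro measurable_from_subalg[OF _ assms]) (auto simp: subalgebra_def)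
qed

text \<open>The \<open>\<sigma>\<close>-algebras generated by \<open>X\<close> and \<open>Y\<close>
  lie inside those of the void events over \<open>H\<close> and \<open>H'\<close>, which are
  independent.\<close>

lemma indep_var_void:
  assumes X: "X \<in> measurable (sigma (space P) (void_events P \<Lambda> N H)) S"
    and Y: "Y \<in> measurable (sigma (space P) (void_events P \<Lambda> N H')) T"
    and "H \<inter> H' = {}"
  shows "indep_var S X T Y"
  unfolding indep_var_eq
proof (intro conjI measurable_from_void[OF X] measurable_from_void[OF Y])
  have pre: "sigma_sets (space P) {Z -` B \<inter> space P | B. B \<in> sets U}
      \<subseteq> sigma_sets (space P) (void_events P \<Lambda> N J)"
    if "Z \<in> measurable (sigma (space P) (void_events P \<Lambda> N J)) U" for Z J and U :: "'c measure"
  proof (rule sigma_sets_mono, safe)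
    have sub: "void_events P \<Lambda> N J \<subseteq> Pow (space P)" by (auto simp: void_events_def)
    fix B assume "B \<in> sets U"
    from measurable_sets[OF that this]
    show "Z -` B \<inter> space P \<in> sigma_sets (space P) (void_events P \<Lambda> N J)"
      using sub by (simp add: space_measure_of)
  qed
  have "indep_set (sigma_sets (space P) (void_events P \<Lambda> N H))
      (sigma_sets (space P) (void_events P \<Lambda> N H'))"
    using assms(3) by (intro indep_void_events prob_space_axioms poisson bounded_finite_intensity)
  then show "indep_set (sigma_sets (space P) {X -` A \<inter> space P | A. A \<in> sets S})
      (sigma_sets (space P) {Y -` A \<inter> space P | A. A \<in> sets T})"
    using pre[OF X] pre[OF Y] unfolding indep_sets2_eq by blast
qed

text \<open>Reads the full field as the field over all locations, so the results for general
  \<open>H\<close> cover it.\<close>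

lemma crystal_field_eq: "crystal_field A N \<omega> = (\<lambda>x. INF g\<in>{g \<in> N \<omega>. fst g \<in> UNIV}. A g x)"
  by (auto simp: crystal_field_def)

lemma field_measurable: "(\<lambda>\<omega>. crystal_field A N \<omega> x) \<in> borel_measurable P"
  unfolding crystal_field_eq using field_measurable_void[of UNIV x] by (intro measurable_from_void) auto

lemma crystal_field_continuous: "\<omega> \<in> space P \<Longrightarrow> continuous_on UNIV (crystal_field A N \<omega>)"
  unfolding crystal_field_eq by (rule field_continuous)

lemma restricted_field_measurable:
  "(\<lambda>\<omega>. restrict (crystal_field A N \<omega>) T) \<in> measurable P (cont_space T)"
  by (intro measurable_restrict_cont_space field_measurable)
    (auto intro: continuous_on_subset[OF crystal_field_continuous])

section \<open>The regularity bound and its decay\<close>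

lemma abs_reg_coeff_crystal_field:
  "abs_reg_coeff P (crystal_field A N) T1 T2 =
    variation_norm_diff
      (distr P (cont_space T1 \<Otimes>\<^sub>M cont_space T2)
        (\<lambda>\<omega>. (restrict (crystal_field A N \<omega>) T1, restrict (crystal_field A N \<omega>) T2)))
      (distr P (cont_space T1) (\<lambda>\<omega>. restrict (crystal_field A N \<omega>) T1)
        \<Otimes>\<^sub>M distr P (cont_space T2) (\<lambda>\<omega>. restrict (crystal_field A N \<omega>) T2))"
  by (intro abs_reg_coeff_eq field_measurable crystal_field_continuous)

lemma abs_reg_coeff_nonneg: "0 \<le> abs_reg_coeff P (crystal_field A N) T1 T2"
proof -
  let ?X = "\<lambda>T \<omega>. restrict (crystal_field A N \<omega>) T"
  interpret X1: prob_space "distr P (cont_space T1) (?X T1)"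
    by (intro prob_space_distr restricted_field_measurable)
  interpret X2: prob_space "distr P (cont_space T2) (?X T2)"
    by (intro prob_space_distr restricted_field_measurable)
  interpret X12: pair_prob_space "distr P (cont_space T1) (?X T1)" "distr P (cont_space T2) (?X T2)" ..
  show ?thesis
    unfolding abs_reg_coeff_crystal_field
  proof (rule variation_norm_diff_nonneg[OF _ X12.prob_space_axioms])
    show "prob_space (distr P (cont_space T1 \<Otimes>\<^sub>M cont_space T2) (\<lambda>\<omega>. (?X T1 \<omega>, ?X T2 \<omega>)))"
      by (intro prob_space_distr measurable_Pair restricted_field_measurable)
  qed simp
qed

lemma abs_reg_coeff_le:
  assumes r: "r > 0"
  shows "abs_reg_coeff P (crystal_field A N) {..0} {r..}
    \<le> 8 * exp (- measure \<Lambda> (causal_cone A (r / (2 * M))))"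
proof -
  define t where "t = r / (2 * M)"
  have Mt: "M * t = r / 2" using M_pos by (simp add: t_def)
  \<comment> \<open>The strict inequality ensures that a hit in \<open>K1\<close> provides a germ of
    the left field; germs at exactly \<open>r / 2\<close> are assigned to the right field.\<close>
  define K1 where "K1 = {g \<in> germs. A g 0 \<le> t \<and> fst g < r / 2}"
  define K2 where "K2 = {g \<in> germs. A g r \<le> t}"
  let ?D = "\<lambda>K. {\<omega> \<in> space P. N \<omega> \<inter> K = {}}"
  let ?X = "\<lambda>T \<omega>. restrict (crystal_field A N \<omega>) T"
  let ?Y = "\<lambda>H T \<omega>. \<lambda>x\<in>T. INF g\<in>{g \<in> N \<omega>. fst g \<in> H}. A g x"
  have K: "K1 \<in> sets \<Lambda>" "bounded K1" "K2 \<in> sets \<Lambda>" "bounded K2"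
    using cone_sets[of "{..<r / 2}" 0 t] cone_sets[of UNIV r t] bounded_cone[of r t]
      bounded_subset[OF bounded_cone[of 0 t], of K1]
    by (auto simp: K1_def K2_def)
  have sub: "N \<omega> \<subseteq> germs" if "\<omega> \<in> space P" for \<omega>
    using poisson that by (auto simp: poisson_process_def space_intensity)
  have "indep_var (cont_space {..0}) (?Y {..<r / 2} {..0}) (cont_space {r..}) (?Y {r / 2..} {r..})"
    by (rule indep_var_void[OF restricted_field_measurable_void restricted_field_measurable_void]) auto
  moreover have "?X {..0} \<omega> = ?Y {..<r / 2} {..0} \<omega>" if \<omega>: "\<omega> \<in> space P - ?D K1" for \<omega>
  proof -
    obtain g0 where g0: "g0 \<in> N \<omega>" "A g0 0 \<le> t" "fst g0 < r / 2"
      using \<omega> by (auto simp: K1_def)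
    moreover have "M * A g0 0 \<le> r / 2"
      using mult_left_mono[OF g0(2), of M] M_pos Mt by linarith
    ultimately show ?thesis
      using INF_left_determined[of "N \<omega>" g0 "r / 2"] sub[of \<omega>] \<omega>
      by (auto simp: crystal_field_def fun_eq_iff)
  qed
  moreover have "?X {r..} \<omega> = ?Y {r / 2..} {r..} \<omega>" if \<omega>: "\<omega> \<in> space P - ?D K2" for \<omega>
  proof -
    obtain g0 where g0: "g0 \<in> N \<omega>" "g0 \<in> germs" "A g0 r \<le> t"
      using \<omega> by (auto simp: K2_def)
    moreover have "r / 2 \<le> fst g0"
      using cone_right_of_in[of t r "r / 2" g0] g0 Mt by simp
    moreover have "M * A g0 r \<le> r - r / 2"
      using mult_left_mono[OF g0(3), of M] M_pos Mt by linarith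
    ultimately show ?thesis
      using INF_right_determined[of "N \<omega>" g0 "r / 2" r] sub[of \<omega>] \<omega>
      by (auto simp: crystal_field_def fun_eq_iff)
  qed
  ultimately have "abs_reg_coeff P (crystal_field A N) {..0} {r..}
      \<le> 4 * (prob (?D K1) + prob (?D K2))"
    unfolding abs_reg_coeff_crystal_field
    using K
    by (intro variation_norm_diff_coupling prob_space_axioms restricted_field_measurable
        poisson_process_void_prob(1)[OF poisson]) auto
  also have "prob (?D K1) = exp (- measure \<Lambda> (causal_cone A t))"
    unfolding poisson_process_void_prob(2)[OF poisson K(1,2)]
    using cone_measure_trim[of t "r / 2"] Mt by (simp add: K1_def)
  also have "prob (?D K2) = exp (- measure \<Lambda> (causal_cone A t))"
    unfolding poisson_process_void_prob(2)[OF poisson K(3,4)]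
    using cone_measure_translate[of r t] by (simp add: K2_def)
  finally show ?thesis by (simp add: t_def)
qed

text \<open>The cone eventually contains rectangles of arbitrary width over a fixed range of birth
  times with positive mass. This makes the exponential bound tend to 0.\<close>

lemma causal_cone_measure_at_top:
  assumes m_nonzero: "emeasure m (space m) \<noteq> 0"
    and reach: "\<And>tg r. tg \<ge> 0 \<Longrightarrow> r > 0 \<Longrightarrow> \<exists>t>0. {-r..r} \<subseteq> free_crystal A (0, tg) t"
  shows "filterlim (\<lambda>t. measure \<Lambda> (causal_cone A t)) at_top at_top"
proof -
  \<comment> \<open>Otherwise \<open>space m\<close> would be a countable union of null
    intervals.\<close>
  have "\<exists>a>0. emeasure m {0..a} \<noteq> 0"
  proof (rule ccontr)
    assume none: "\<not> (\<exists>a>0. emeasure m {0..a} \<noteq> 0)"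
    have "emeasure m {0..real n + 1} = 0" for n
      using none by (metis add_pos_nonneg add.commute of_nat_0_le_iff zero_less_one)
    then have "(\<Union>n. {0..real n + 1}) \<in> null_sets m"
      by (intro null_sets_UN) (auto intro!: sets_mI)
    moreover have "space m \<subseteq> (\<Union>n. {0..real n + 1})"
    proof
      fix x assume "x \<in> space m"
      moreover obtain n where "x \<le> real n" using real_arch_simple by blast
      ultimately show "x \<in> (\<Union>n. {0..real n + 1})" by (auto simp: space_m intro!: exI[of _ n])
    qed
    ultimately have "space m \<in> null_sets m"
      by (rule null_sets_subset[OF _ sets.top])
    then show False using m_nonzero by auto
  qed
  then obtain a where a: "a > 0" "emeasure m {0..a} \<noteq> 0" by auto
  define c where "c = measure m {0..a}"
  have c: "c > 0"
    using a m_finite[OF a(1)] by (auto simp: c_def measure_def enn2real_positive_iff zero_less_iff_neq_zero)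
  have K: "causal_cone A t \<in> sets \<Lambda>" "bounded (causal_cone A t)" for t
    using cone_sets[of UNIV 0 t] bounded_cone[of 0 t] by (auto simp: causal_cone_def)
  show ?thesis
    unfolding filterlim_at_top_gt[where c = 0]
  proof safe
    fix Z :: real assume Z: "Z > 0"
    \<comment> \<open>Chosen so that the rectangle of width \<open>2 * R\<close> over
      \<open>{0..a}\<close> has intensity exactly \<open>Z\<close>. Reachability is invoked for the
      latest birth time \<open>a\<close>; earlier births arrive no later.\<close>
    define R where "R = Z / (2 * c)"
    have R: "R > 0" using Z c by (simp add: R_def)
    obtain t where t: "t > 0" "{-R..R} \<subseteq> free_crystal A (0, a) t"
      using reach[of a R] a R by auto
    have "Z \<le> measure \<Lambda> (causal_cone A t')" if "t' \<ge> t" for t'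
    proof -
      have sub: "{-R..R} \<times> {0..a} \<subseteq> causal_cone A t'"
      proof safe
        fix u s assume us: "u \<in> {-R..R}" "s \<in> {0..a}"
        have "A (u, s) 0 = A (0, s) (- u)"
          using us by (subst translate) (auto simp: germs_def)
        also have "\<dots> \<le> A (0, a) (- u)"
          using us by (intro arrival_mono_birth) auto
        also have "\<dots> \<le> t"
        proof -
          have "- u \<in> free_crystal A (0, a) t"
            by (rule subsetD[OF t(2)]) (use us in auto)
          then show ?thesis by (simp add: free_crystal_def)
        qed
        finally show "(u, s) \<in> causal_cone A t'"
          using us that by (auto simp: causal_cone_def germs_def)
      qed
      have "Z = measure \<Lambda> ({-R..R} \<times> {0..a})"
      proof -
        have "measure \<Lambda> ({-R..R} \<times> {0..a}) = 2 * R * c"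
          using R by (simp add: measure_def emeasure_window enn2real_mult c_def)
        then show ?thesis using c by (simp add: R_def)
      qed
      also have "\<dots> \<le> measure \<Lambda> (causal_cone A t')"
      proof (rule measure_mono_fmeasurable[OF sub])
        show "{-R..R} \<times> {0..a} \<in> sets \<Lambda>" by (intro Times_sets) auto
        show "causal_cone A t' \<in> fmeasurable \<Lambda>"
          using bounded_finite_intensity[OF K] K(1) by (intro fmeasurableI) (simp_all add: less_top)
      qed
      finally show ?thesis .
    qed
    then show "\<forall>\<^sub>F t in at_top. Z \<le> measure \<Lambda> (causal_cone A t)"
      by (rule eventually_at_top_linorderI)
  qed
qed

end

theorem theorem2:
  fixes P :: "'w measure"
    and m :: "real measure"
    and \<Lambda> :: "(real \<times> real) measure"
    and N :: "'w \<Rightarrow> (real \<times> real) set"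
    and A :: "real \<times> real \<Rightarrow> real \<Rightarrow> real"
    and \<xi> :: "'w \<Rightarrow> real \<Rightarrow> real"
    and F :: "real \<Rightarrow> real"
    and \<beta> :: "real \<Rightarrow> real"
    and M :: real
  assumes prob: "prob_space P"
    and m_sets: "sets m = sets (restrict_space borel {0..})"
    and m_nonzero: "emeasure m (space m) \<noteq> 0"
    and m_finite: "\<And>a. a > 0 \<Longrightarrow> emeasure m {0..a} < \<infinity>"
    and \<Lambda>_eq: "\<Lambda> = lborel \<Otimes>\<^sub>M m"
    and poisson: "poisson_process P \<Lambda> N"
    and A_nonneg: "\<And>g x. g \<in> germs \<Longrightarrow> A g x \<ge> 0"
    and A1: "\<And>g x. g \<in> germs \<Longrightarrow> A g x = A (0, snd g) (x - fst g)"
    and A2: "\<And>g. g \<in> germs \<Longrightarrow> A g (fst g) = snd g"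
            "\<And>g x. g \<in> germs \<Longrightarrow> A g x \<ge> snd g"
    and A3: "\<And>g t. g \<in> germs \<Longrightarrow> t \<ge> 0 \<Longrightarrow>
               bounded (free_crystal A g t) \<and> convex (free_crystal A g t)"
            "\<And>g s t. g \<in> germs \<Longrightarrow> 0 \<le> s \<Longrightarrow> s < t \<Longrightarrow>
               free_crystal A g s \<subseteq> free_crystal A g t"
    and A4: "\<And>g. g \<in> germs \<Longrightarrow> continuous_on UNIV (A g)"
            "\<And>g t. g \<in> germs \<Longrightarrow> t \<ge> 0 \<Longrightarrow> frontier (free_crystal A g t) = {x. A g x = t}"
    and A5: "M > 0"
            "\<And>tg x. tg \<ge> 0 \<Longrightarrow> A (0, tg) x \<ge> tg + 1 / M * \<bar>x\<bar>"
    and A6: "\<And>tg r. tg \<ge> 0 \<Longrightarrow> r > 0 \<Longrightarrow> \<exists>t>0. {-r..r} \<subseteq> free_crystal A (0, tg) t"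
    and A7a: "\<And>g1 g2 x0 x. g1 \<in> germs \<Longrightarrow> g2 \<in> germs \<Longrightarrow> x0 \<ge> fst g1 \<Longrightarrow>
                A g1 x0 \<ge> A g2 x0 \<Longrightarrow> x \<ge> x0 \<Longrightarrow> A g1 x \<ge> A g2 x"
             "\<And>g1 g2 x1 x. g1 \<in> germs \<Longrightarrow> g2 \<in> germs \<Longrightarrow> x1 \<le> fst g1 \<Longrightarrow>
                A g1 x1 \<ge> A g2 x1 \<Longrightarrow> x \<le> x1 \<Longrightarrow> A g1 x \<ge> A g2 x"
    and \<xi>_eq: "\<xi> = crystal_field A N"
    and F_eq: "\<And>t. F t = measure \<Lambda> (causal_cone A t)"
    and \<beta>_eq: "\<And>r. r > 0 \<Longrightarrow> \<beta> r = abs_reg_coeff P \<xi> {..0} {r..}"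
  shows "(\<beta> \<longlongrightarrow> 0) at_top \<and> (\<forall>r>0. \<beta> r \<le> 16 * exp (- F (1 / (2 * M) * r)))"
proof -
  interpret prob_space P by fact
  interpret poisson_crystal_process A M P m \<Lambda> N
    by unfold_locales (fact assms)+
  have bound: "\<beta> r \<le> 8 * exp (- F (1 / (2 * M) * r))" if "r > 0" for r
    using abs_reg_coeff_le[OF that] \<beta>_eq[OF that] by (simp add: \<xi>_eq F_eq)
  have nonneg: "\<beta> r \<ge> 0" if "r > 0" for r
    using abs_reg_coeff_nonneg \<beta>_eq[OF that] by (simp add: \<xi>_eq)
  have "filterlim F at_top at_top"
    using causal_cone_measure_at_top[OF m_nonzero A6] by (simp add: F_eq[abs_def])
  moreover have "filterlim (\<lambda>r. 1 / (2 * M) * r) at_top at_top"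
    using A5(1) by (intro filterlim_tendsto_pos_mult_at_top[OF tendsto_const]) (auto simp: filterlim_ident)
  ultimately have "filterlim (\<lambda>r. F (1 / (2 * M) * r)) at_top at_top"
    by (rule filterlim_compose)
  then have "((\<lambda>r. exp (- F (1 / (2 * M) * r))) \<longlongrightarrow> 0) at_top"
    by (intro filterlim_compose[OF exp_at_bot] filterlim_compose[OF filterlim_uminus_at_bot_at_top])
  then have lim: "((\<lambda>r. 8 * exp (- F (1 / (2 * M) * r))) \<longlongrightarrow> 0) at_top"
    using tendsto_mult_right_zero by blast
  have "(\<beta> \<longlongrightarrow> 0) at_top"
  proof (rule tendsto_sandwich[OF _ _ tendsto_const lim])
    show "\<forall>\<^sub>F r in at_top. 0 \<le> \<beta> r"
      using eventually_gt_at_top[of 0] by eventually_elim (rule nonneg)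
    show "\<forall>\<^sub>F r in at_top. \<beta> r \<le> 8 * exp (- F (1 / (2 * M) * r))"
      using eventually_gt_at_top[of 0] by eventually_elim (rule bound)
  qed
  \<comment> \<open>The stated constant 16 is a weakening of the constant 8 obtained from the
    coupling.\<close>
  moreover have "\<beta> r \<le> 16 * exp (- F (1 / (2 * M) * r))" if "r > 0" for r
    using bound[OF that] exp_ge_zero[of "- F (1 / (2 * M) * r)"] by linarith
  ultimately show ?thesis by blast
qed

end
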